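(* Let $\lambda>0$. For a given $\epsilon>0$, the enhanced adaptive sieving algorithm (Algorithm EAS, described in the context) is guaranteed to converge in a finite number of iterations. The number of sieving iterations of Algorithm EAS is no more than that of the adaptive sieving algorithm (Algorithm AS, described in the context). Moreover, the obtained output $(x^*(\lambda),y^*(\lambda),z^*(\lambda))$ of Algorithm EAS is a solution to $(P_\lambda)$ in the sense that $$\|R_\lambda(x^*(\lambda),y^*(\lambda),z^*(\lambda))\|\le\epsilon.$$
   Context: **Problem.** $f:\mathbb{R}^n\to\mathbb{R}$ is a twice continuously differentiable convex function, $p:\mathbb{R}^m\to(-\infty,+\infty]$ is a closed proper convex function, $B:\mathbb{R}^n\to\mathbb{R}^m$ is a linear map (an $m\times n$ matrix). For $\lambda>0$ consider $$(P_\lambda)\qquad \min_{x\in\mathbb{R}^n,\,y\in\mathbb{R}^m} f(x)+\lambda p(y)\quad\text{s.t. } Bx-y=0,$$ with solution set $\Omega_\lambda$; write $F_\lambda(x)=f(x)+\lambda p(Bx)$. **KKT residual.** For $(x,y,z)\in\mathbb{R}^n\times\mathbb{R}^m\times\mathbb{R}^m$, $$R_\lambda(x,y,z):=\big(\nabla f(x)+B^Tz,\ \ y-\mathrm{Prox}_{\lambda p}(y+z),\ \ Bx-y\big).$$ **Notation.** $[m]=\{1,\dots,m\}$; $I^c=[m]\setminus I$; $\|\cdot\|$ is the Euclidean norm; $\Pi_C$ is Euclidean projection onto a closed convex set $C$; $B_{KL}$ is the submatrix with rows in $K$ and columns in $L$, and $B_{I:}$ the submatrix of rows in $I$; $v_K$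 is the subvector of $v$ indexed by $K$. $\partial(\lambda p(y))$ denotes the subdifferential of $\lambda p$ at $y$, and for $S\subseteq\mathbb{R}^m$ and an index set $K$ (or single index $j$), $S_K=\{s_K: s\in S\}$. **Standing assumptions.** (A1) For any $\lambda>0$, $\Omega_\lambda$ is nonempty and compact. (A2) For any $\lambda>0$ and $y\in\mathbb{R}^m$, with $I^c:=\{i\in[m]: y_i\neq0\}$, if $I^c\ne\emptyset$ then $(\partial(\lambda p(y)))_{I^c}$ is a singleton. **Reduction for $I\subseteq[m]$.** Assume that the rank $r$ of $B_{I:}$ satisfies $r>0$. $[n]$ is partitioned into index sets $\alpha,\beta,\gamma$ with $|\gamma|=r$, $B_{I\beta}=0$ and $B_{I\gamma}$ of full column rank. It is also assumed that $\alpha\neq\emptyset$ (otherwise the constraint forces $x_\gamma=0$). $M_{\gamma\alpha}$ is the unique $|\gamma|\times|\alpha|$ matrix with $B_{I\alpha}+B_{I\gamma}M_{\gamma\alpha}=0$. Define $\varphi(x_\alpha,x_\beta)=f(\dot x)$ with $\dot x_\alpha=x_\alpha$, $\dot x_\beta=x_\beta$, $\dot x_\gamma=M_{\gamma\alpha}x_\alpha$, and $q(y_{I^c})=p(\dot y)$ with $\dot y_{I^c}=y_{I^c}$, $\dot y_I=0$. The reduced subproblem is $$(RP_\lambda(I))\qquad \min_{x_\alpha,x_\beta,y_{I^c}}\ \varphi(x_\alpha,x_\beta)+\lambda q(y_{I^c})\quad\text{s.t. }(B_{I^c\alpha}+B_{I^c\gamma}M_{\gamma\alpha})x_\alpha+B_{I^c\beta}x_\beta-y_{I^c}=0.$$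 **Inexact KKT system.** $(\hat x_\alpha,\hat x_\beta,\hat y_{I^c},\hat\xi)$ satisfies the inexact KKT system of $(RP_\lambda(I))$ with errors $(\hat\delta_1,\hat\delta_2,\hat\delta_3)\in\mathbb{R}^{|\alpha|}\times\mathbb{R}^{|\beta|}\times\mathbb{R}^{|I^c|}$ if, with $\hat x_\gamma=M_{\gamma\alpha}\hat x_\alpha$, $\hat y_I=0$, $$(\nabla f(\hat x))_\alpha+M_{\gamma\alpha}^T(\nabla f(\hat x))_\gamma+(B_{I^c\alpha}+B_{I^c\gamma}M_{\gamma\alpha})^T\hat\xi+\hat\delta_1=0,\quad (\nabla f(\hat x))_\beta+B_{I^c\beta}^T\hat\xi+\hat\delta_2=0,$$ $$\hat\xi+\hat\delta_3\in(\partial(\lambda p(\hat y)))_{I^c},\quad (B_{I^c\alpha}+B_{I^c\gamma}M_{\gamma\alpha})\hat x_\alpha+B_{I^c\beta}\hat x_\beta-\hat y_{I^c}=0.$$ **Primal recovery.** $\bar x_\alpha=\hat x_\alpha$, $\bar x_\beta=\hat x_\beta$, $\bar x_\gamma=M_{\gamma\alpha}\hat x_\alpha$, $\bar y_{I^c}=\hat y_{I^c}$, $\bar y_I=0$. **Dual recovery.** $\bar u_{I^c}=\hat\xi$, $(\bar u_I)_0=-B_{I\gamma}(B_{I\gamma}^TB_{I\gamma})^{-1}\big((\nabla f(\bar x))_\gamma+B_{I^c\gamma}^T\bar u_{I^c}\big)$, $\bar u_I=(\bar u_I)_0+\bar d$, $\bar w=\bar u_I-\Pi_{(\partial(\lambda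 p(\bar y)))_I}(\bar u_I)$, where $\bar d$ is a solution of $\min_{d\in\mathrm{Null}(B_{I\gamma}^T)}\tfrac12\|((\bar u_I)_0+d)-\Pi_{(\partial(\lambda p(\bar y)))_I}((\bar u_I)_0+d)\|^2$. **Enhanced dual recovery.** Given $\tilde x$, let $\tilde y=B\tilde x$, $\tilde I=\{k\in[m]:\tilde y_k=0\}$, and let $\tilde\alpha,\tilde\beta,\tilde\gamma,M_{\tilde\gamma\tilde\alpha}$ be associated with $\tilde I$ in the same way as $\alpha,\beta,\gamma,M_{\gamma\alpha}$ with $I$ (again with $\tilde\alpha\neq\emptyset$ assumed). Let $\tilde v_{\tilde I^c}$ be the unique element of $(\partial(\lambda p(\tilde y)))_{\tilde I^c}$ and $\tilde v_{\tilde I}=(\tilde v_{\tilde I})_0+\tilde d$, $\tilde s=\tilde v_{\tilde I}-\Pi_{(\partial(\lambda p(\tilde y)))_{\tilde I}}(\tilde v_{\tilde I})$, with $(\tilde v_{\tilde I})_0=-B_{\tilde I\tilde\gamma}(B_{\tilde I\tilde\gamma}^TB_{\tilde I\tilde\gamma})^{-1}\big((\nabla f(\tilde x))_{\tilde\gamma}+B_{\tilde I^c\tilde\gamma}^T\tilde v_{\tilde I^c}\big)$ and $\tilde d$ an optimal solution of $\min_{d\in\mathrm{Null}(B_{\tilde I\tilde\gamma}^T)}\tfrac12\|((\tilde v_{\tilde I})_0+d)-\Pi_{(\partial(\lambda p(\tilde y)))_{\tilde I}}((\tilde v_{\tilde I})_0+d)\|^2$. **Algorithm EAS** (input $\lambda>0$,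 $\epsilon>0$; initial index set $I^0\subseteq[m]$ generated by a predefined initialization strategy). For $i=0,1,2,\dots$: 1. For the index set $I^i$, construct the partition $\{\alpha^i,\beta^i,\gamma^i\}$ and $M_{\gamma^i\alpha^i}$. 2. Apply any well designed algorithm to solve $(RP_\lambda(I^i))$ and obtain an inexact solution satisfying the inexact KKT system with latent errors such that $\|\hat\delta_1^i\|+\|\hat\delta_2^i\|+\|\hat\delta_3^i\|\le\epsilon$. 3. Recover $(\bar x^i,\bar y^i)$ by primal recovery. If $i>1$ and $|F_\lambda(\bar x^i)-F_\lambda(\bar x^{i-1})|\le\epsilon$, set $(\tilde x^i,\tilde y^i)=(\bar x^i,B\bar x^i)$, construct $(\tilde v^i,\tilde s^i)$ by enhanced dual recovery, and if $\|R_\lambda(\tilde x^i,\tilde y^i,\tilde v^i)\|\le\epsilon$, stop and output $(x^*(\lambda),y^*(\lambda),z^*(\lambda))=(\tilde x^i,\tilde y^i,\tilde v^i)$. 4. Recover $(\bar u^i,\bar w^i)$ by dual recovery. If $\|R_\lambda(\bar x^i,\bar y^i,\bar u^i)\|\le\epsilon$, stop and output $(x^*(\lambda),y^*(\lambda),z^*(\lambda))=(\bar x^i,\bar y^i,\bar u^i)$. Otherwise let $J^i=\{j\in I^i\mid \bar u^i_j\notin(\partial(\lambda p(\bar y^i)))_j\}$; if $J^i\neq\emptyset$ set $I^{i+1}=I^i\setminus J^i$ and continue; if $J^i=\emptyset$, stop and output $(x^*(\lambda),y^*(\lambda),z^*(\lambda))=(\bar x^i,\bar y^i,\bar u^i)$.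 **Algorithm AS** is Algorithm EAS with the conditional early-stopping test in Step 3 (everything after the primal recovery of $(\bar x^i,\bar y^i)$ in Step 3) removed. Sieving iterations are the iterations of the outer loop over $i$.
   Formalization: The bound ‖R_λ‖≤ε is proved only when s_j∈(∂(λp(y)))_j for all j implies s∈∂(λp(y)); without this it fails (p=‖·‖₂, B=Id). EAS and AS are compared for the same initial set and the same choices in shared steps. *)

theory Defs
  imports "HOL-Analysis.Analysis" "HOL-Library.Extended_Nat"
begin

text \<open>
  Index sets are sets \<open>K\<close> of coordinates of a fixed space \<open>real ^ 'k\<close>. A vector indexed by \<open>K\<close> is
  represented by the vector that agrees with it on \<open>K\<close> and is 0 elsewhere, and a \<open>K \<times> L\<close> matrix
  likewise. Sums, products, transposes, norms and ranks of these zero-padded objects are those of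
  the small ones; only inversion needs a separate definition, \<open>block_inv\<close>.
\<close>

definition subvec :: "'k set \<Rightarrow> real ^ 'k \<Rightarrow> real ^ 'k" where
  "subvec K v = (\<chi> i. if i \<in> K then v $ i else 0)"

definition submat :: "'k set \<Rightarrow> 'l set \<Rightarrow> real ^ 'l ^ 'k \<Rightarrow> real ^ 'l ^ 'k" where
  "submat K L A = (\<chi> i j. if i \<in> K \<and> j \<in> L then A $ i $ j else 0)"

definition block_inv :: "'k set \<Rightarrow> real ^ 'k ^ 'k \<Rightarrow> real ^ 'k ^ 'k" where
  "block_inv K A = (THE N. submat K K N = N \<and>
     N ** A = submat K K (mat 1) \<and> A ** N = submat K K (mat 1))"

definition gradient :: "('a :: real_inner \<Rightarrow> real) \<Rightarrow> 'a \<Rightarrow> 'a" where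
  "gradient f x = (THE g. GDERIV f x :> g)"

definition twice_continuously_differentiable :: "(real ^ 'n \<Rightarrow> real) \<Rightarrow> bool" where
  "twice_continuously_differentiable f \<longleftrightarrow>
     (\<forall>x. f differentiable (at x)) \<and>
     (\<exists>H :: real ^ 'n \<Rightarrow> real ^ 'n ^ 'n.
        (\<forall>x. (gradient f has_derivative (\<lambda>h. H x *v h)) (at x)) \<and> continuous_on UNIV H)"

definition epi :: "('a \<Rightarrow> ereal) \<Rightarrow> ('a \<times> real) set" where
  "epi h = {(y, t). h y \<le> ereal t}"

definition closed_proper_convex :: "('a :: euclidean_space \<Rightarrow> ereal) \<Rightarrow> bool" where
  "closed_proper_convex h \<longleftrightarrow>
     (\<forall>y. h y \<noteq> - \<infinity>) \<and> (\<exists>y. h y \<noteq> \<infinity>) \<and> convex (epi h) \<and> closed (epi h)"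

definition subdifferential :: "('a :: real_inner \<Rightarrow> ereal) \<Rightarrow> 'a \<Rightarrow> 'a set" where
  "subdifferential h y = {s. \<forall>w. h y + ereal (s \<bullet> (w - y)) \<le> h w}"

definition scaled :: "real \<Rightarrow> ('a \<Rightarrow> ereal) \<Rightarrow> 'a \<Rightarrow> ereal" where
  "scaled lam p y = ereal lam * p y"

definition prox :: "('a :: real_inner \<Rightarrow> ereal) \<Rightarrow> 'a \<Rightarrow> 'a" where
  "prox h v = arg_min (\<lambda>w. h w + ereal ((norm (w - v))\<^sup>2 / 2)) (\<lambda>_. True)"

definition objective ::
  "(real ^ 'n \<Rightarrow> real) \<Rightarrow> (real ^ 'm \<Rightarrow> ereal) \<Rightarrow> real ^ 'n ^ 'm \<Rightarrow> real \<Rightarrow> real ^ 'n \<Rightarrow> ereal" where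
  "objective f p B lam x = ereal (f x) + scaled lam p (B *v x)"

definition solution_set ::
  "(real ^ 'n \<Rightarrow> real) \<Rightarrow> (real ^ 'm \<Rightarrow> ereal) \<Rightarrow> real ^ 'n ^ 'm \<Rightarrow> real \<Rightarrow>
     ((real ^ 'n) \<times> (real ^ 'm)) set" where
  "solution_set f p B lam =
     {(x, y). p y \<noteq> \<infinity> \<and>
        is_arg_min (\<lambda>(x, y). ereal (f x) + scaled lam p y) (\<lambda>(x, y). B *v x - y = 0) (x, y)}"

definition kkt_residual ::
  "(real ^ 'n \<Rightarrow> real) \<Rightarrow> (real ^ 'm \<Rightarrow> ereal) \<Rightarrow> real ^ 'n ^ 'm \<Rightarrow> real \<Rightarrow>
     (real ^ 'n) \<times> (real ^ 'm) \<times> (real ^ 'm) \<Rightarrow> (real ^ 'n) \<times> (real ^ 'm) \<times> (real ^ 'm)" where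
  "kkt_residual f p B lam = (\<lambda>(x, y, z).
     (gradient f x + transpose B *v z, y - prox (scaled lam p) (y + z), B *v x - y))"

definition assumption_A1 ::
  "(real ^ 'n \<Rightarrow> real) \<Rightarrow> (real ^ 'm \<Rightarrow> ereal) \<Rightarrow> real ^ 'n ^ 'm \<Rightarrow> bool" where
  "assumption_A1 f p B \<longleftrightarrow>
     (\<forall>lam > 0. solution_set f p B lam \<noteq> {} \<and> compact (solution_set f p B lam))"

definition assumption_A2 :: "(real ^ 'm \<Rightarrow> ereal) \<Rightarrow> bool" where
  "assumption_A2 p \<longleftrightarrow>
     (\<forall>lam > 0. \<forall>y. {i. y $ i \<noteq> 0} \<noteq> {} \<longrightarrow>
        is_singleton (subvec {i. y $ i \<noteq> 0} ` subdifferential (scaled lam p) y))"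

text \<open>
  Membership in every subdifferential can be tested one coordinate at a time. This holds for
  separable and for differentiable functions, but fails for the Euclidean norm at 0. The algorithms
  rely on it when they stop because no coordinate of the dual vector is violated: without it such
  a vector need not be a subgradient.
\<close>

definition coordinatewise_subdifferential :: "(real ^ 'm \<Rightarrow> ereal) \<Rightarrow> bool" where
  "coordinatewise_subdifferential h \<longleftrightarrow>
     (\<forall>y s. (\<forall>j. s $ j \<in> (\<lambda>t. t $ j) ` subdifferential h y) \<longrightarrow> s \<in> subdifferential h y)"

text \<open>The reduction associated with \<open>I\<close>; \<open>M\<close> is the \<open>\<gamma> \<times> \<alpha>\<close> matrix expressing \<open>x\<^sub>\<gamma>\<close> by \<open>x\<^sub>\<alpha>\<close>.\<close>

definition reduction ::
  "real ^ 'n ^ 'm \<Rightarrow> 'm set \<Rightarrow> 'n set \<Rightarrow> 'n set \<Rightarrow> 'n set \<Rightarrow> real ^ 'n ^ 'n \<Rightarrow> bool" where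
  "reduction B I \<alpha> \<beta> \<gamma> M \<longleftrightarrow>
     0 < rank (submat I UNIV B) \<and>
     \<alpha> \<union> \<beta> \<union> \<gamma> = UNIV \<and> \<alpha> \<inter> \<beta> = {} \<and> \<alpha> \<inter> \<gamma> = {} \<and> \<beta> \<inter> \<gamma> = {} \<and>
     card \<gamma> = rank (submat I UNIV B) \<and> submat I \<beta> B = 0 \<and>
     rank (submat I \<gamma> B) = card \<gamma> \<and> \<alpha> \<noteq> {} \<and>
     submat \<gamma> \<alpha> M = M \<and> submat I \<alpha> B + submat I \<gamma> B ** M = 0"

definition inexact_kkt ::
  "(real ^ 'n \<Rightarrow> real) \<Rightarrow> (real ^ 'm \<Rightarrow> ereal) \<Rightarrow> real ^ 'n ^ 'm \<Rightarrow> real \<Rightarrow>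
     'm set \<Rightarrow> 'n set \<Rightarrow> 'n set \<Rightarrow> 'n set \<Rightarrow> real ^ 'n ^ 'n \<Rightarrow>
     (real ^ 'n) \<times> (real ^ 'n) \<times> (real ^ 'm) \<times> (real ^ 'm) \<Rightarrow>
     (real ^ 'n) \<times> (real ^ 'n) \<times> (real ^ 'm) \<Rightarrow> bool" where
  "inexact_kkt f p B lam I \<alpha> \<beta> \<gamma> M = (\<lambda>(x\<alpha>, x\<beta>, y, \<xi>) (\<delta>1, \<delta>2, \<delta>3).
     let g = gradient f (x\<alpha> + x\<beta> + M *v x\<alpha>);
         C = submat (- I) \<alpha> B + submat (- I) \<gamma> B ** M
     in subvec \<alpha> x\<alpha> = x\<alpha> \<and> subvec \<beta> x\<beta> = x\<beta> \<and> subvec (- I) y = y \<and> subvec (- I) \<xi> = \<xi> \<and>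
        subvec \<alpha> \<delta>1 = \<delta>1 \<and> subvec \<beta> \<delta>2 = \<delta>2 \<and> subvec (- I) \<delta>3 = \<delta>3 \<and>
        subvec \<alpha> g + transpose M *v subvec \<gamma> g + transpose C *v \<xi> + \<delta>1 = 0 \<and>
        subvec \<beta> g + transpose (submat (- I) \<beta> B) *v \<xi> + \<delta>2 = 0 \<and>
        \<xi> + \<delta>3 \<in> subvec (- I) ` subdifferential (scaled lam p) y \<and>
        C *v x\<alpha> + submat (- I) \<beta> B *v x\<beta> - y = 0)"

text \<open>
  Steps 1, 2 and primal recovery for the index set \<open>I\<close>: a reduction with third block \<open>\<gamma>\<close>, an
  inexact solution of the reduced subproblem with multiplier \<open>\<xi>\<close> and total error at most \<open>eps\<close>,
  and the recovered pair \<open>(x, y)\<close>.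
\<close>

definition primal_stage ::
  "(real ^ 'n \<Rightarrow> real) \<Rightarrow> (real ^ 'm \<Rightarrow> ereal) \<Rightarrow> real ^ 'n ^ 'm \<Rightarrow> real \<Rightarrow> real \<Rightarrow>
     'm set \<Rightarrow> 'n set \<Rightarrow> real ^ 'm \<Rightarrow> real ^ 'n \<Rightarrow> real ^ 'm \<Rightarrow> bool" where
  "primal_stage f p B lam eps I \<gamma> \<xi> x y \<longleftrightarrow>
     (\<exists>\<alpha> \<beta> M x\<alpha> x\<beta> yc \<delta>1 \<delta>2 \<delta>3.
        reduction B I \<alpha> \<beta> \<gamma> M \<and>
        inexact_kkt f p B lam I \<alpha> \<beta> \<gamma> M (x\<alpha>, x\<beta>, yc, \<xi>) (\<delta>1, \<delta>2, \<delta>3) \<and>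
        norm \<delta>1 + norm \<delta>2 + norm \<delta>3 \<le> eps \<and>
        x = x\<alpha> + x\<beta> + M *v x\<alpha> \<and> y = yc)"

text \<open>
  Recovery of the dual vector \<open>u\<close> from its part \<open>uc\<close> outside \<open>I\<close>, together with the distance
  vector \<open>w\<close> on \<open>I\<close>.
\<close>

definition dual_recovery ::
  "(real ^ 'n \<Rightarrow> real) \<Rightarrow> (real ^ 'm \<Rightarrow> ereal) \<Rightarrow> real ^ 'n ^ 'm \<Rightarrow> real \<Rightarrow>
     'm set \<Rightarrow> 'n set \<Rightarrow> real ^ 'm \<Rightarrow> real ^ 'n \<Rightarrow> real ^ 'm \<Rightarrow> real ^ 'm \<Rightarrow> real ^ 'm \<Rightarrow> bool" where
  "dual_recovery f p B lam I \<gamma> uc x y u w \<longleftrightarrow>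
     (let A = submat I \<gamma> B;
          S = subvec I ` subdifferential (scaled lam p) y;
          u0 = - (A *v (block_inv \<gamma> (transpose A ** A) *v
                   (subvec \<gamma> (gradient f x) + transpose (submat (- I) \<gamma> B) *v uc)))
      in \<exists>d. is_arg_min (\<lambda>d. (norm ((u0 + d) - closest_point S (u0 + d)))\<^sup>2 / 2)
               (\<lambda>d. subvec I d = d \<and> transpose A *v d = 0) d \<and>
             u = uc + (u0 + d) \<and>
             w = (u0 + d) - closest_point S (u0 + d))"

definition enhanced_dual_recovery ::
  "(real ^ 'n \<Rightarrow> real) \<Rightarrow> (real ^ 'm \<Rightarrow> ereal) \<Rightarrow> real ^ 'n ^ 'm \<Rightarrow> real \<Rightarrow>
     real ^ 'n \<Rightarrow> real ^ 'm \<Rightarrow> real ^ 'm \<Rightarrow> bool" where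
  "enhanced_dual_recovery f p B lam x v s \<longleftrightarrow>
     (let y = B *v x; I = {k. y $ k = 0}
      in \<exists>\<alpha> \<beta> \<gamma> M vc.
           reduction B I \<alpha> \<beta> \<gamma> M \<and>
           subvec (- I) ` subdifferential (scaled lam p) y = {vc} \<and>
           dual_recovery f p B lam I \<gamma> vc x y v s)"

text \<open>
  The choices left open by the algorithms (partitions, inexact subproblem solutions, minimisers
  \<open>d\<close>) are recorded by sequences: \<open>x i\<close>, \<open>y i\<close>, \<open>u i\<close> are the primal and dual recoveries of
  iteration \<open>i\<close>, and \<open>v i\<close> is its enhanced dual recovery. They determine the index sets and the
  stopping tests; their values are irrelevant at iterations (or steps) that are not performed.
\<close>

definition removed ::
  "(real ^ 'm \<Rightarrow> ereal) \<Rightarrow> real \<Rightarrow> 'm set \<Rightarrow> real ^ 'm \<Rightarrow> real ^ 'm \<Rightarrow> 'm set" where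
  "removed p lam I y u = {j \<in> I. u $ j \<notin> (\<lambda>s. s $ j) ` subdifferential (scaled lam p) y}"

primrec index_set ::
  "(real ^ 'm \<Rightarrow> ereal) \<Rightarrow> real \<Rightarrow> 'm set \<Rightarrow> (nat \<Rightarrow> real ^ 'm) \<Rightarrow> (nat \<Rightarrow> real ^ 'm) \<Rightarrow>
     nat \<Rightarrow> 'm set" where
  "index_set p lam I0 y u 0 = I0"
| "index_set p lam I0 y u (Suc i) =
     index_set p lam I0 y u i - removed p lam (index_set p lam I0 y u i) (y i) (u i)"

definition stops_AS ::
  "(real ^ 'n \<Rightarrow> real) \<Rightarrow> (real ^ 'm \<Rightarrow> ereal) \<Rightarrow> real ^ 'n ^ 'm \<Rightarrow> real \<Rightarrow> real \<Rightarrow> 'm set \<Rightarrow>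
     (nat \<Rightarrow> real ^ 'n) \<Rightarrow> (nat \<Rightarrow> real ^ 'm) \<Rightarrow> (nat \<Rightarrow> real ^ 'm) \<Rightarrow> nat \<Rightarrow> bool" where
  "stops_AS f p B lam eps I0 x y u i \<longleftrightarrow>
     norm (kkt_residual f p B lam (x i, y i, u i)) \<le> eps \<or>
     removed p lam (index_set p lam I0 y u i) (y i) (u i) = {}"

definition objective_test ::
  "(real ^ 'n \<Rightarrow> real) \<Rightarrow> (real ^ 'm \<Rightarrow> ereal) \<Rightarrow> real ^ 'n ^ 'm \<Rightarrow> real \<Rightarrow> real \<Rightarrow>
     (nat \<Rightarrow> real ^ 'n) \<Rightarrow> nat \<Rightarrow> bool" where
  "objective_test f p B lam eps x i \<longleftrightarrow>
     i > 1 \<and> \<bar>objective f p B lam (x i) - objective f p B lam (x (i - 1))\<bar> \<le> ereal eps"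

definition stops_early ::
  "(real ^ 'n \<Rightarrow> real) \<Rightarrow> (real ^ 'm \<Rightarrow> ereal) \<Rightarrow> real ^ 'n ^ 'm \<Rightarrow> real \<Rightarrow> real \<Rightarrow>
     (nat \<Rightarrow> real ^ 'n) \<Rightarrow> (nat \<Rightarrow> real ^ 'm) \<Rightarrow> nat \<Rightarrow> bool" where
  "stops_early f p B lam eps x v i \<longleftrightarrow>
     objective_test f p B lam eps x i \<and>
     norm (kkt_residual f p B lam (x i, B *v x i, v i)) \<le> eps"

definition stops_EAS ::
  "(real ^ 'n \<Rightarrow> real) \<Rightarrow> (real ^ 'm \<Rightarrow> ereal) \<Rightarrow> real ^ 'n ^ 'm \<Rightarrow> real \<Rightarrow> real \<Rightarrow> 'm set \<Rightarrow>
     (nat \<Rightarrow> real ^ 'n) \<Rightarrow> (nat \<Rightarrow> real ^ 'm) \<Rightarrow> (nat \<Rightarrow> real ^ 'm) \<Rightarrow> (nat \<Rightarrow> real ^ 'm) \<Rightarrow>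
     nat \<Rightarrow> bool" where
  "stops_EAS f p B lam eps I0 x y u v i \<longleftrightarrow>
     stops_early f p B lam eps x v i \<or> stops_AS f p B lam eps I0 x y u i"

text \<open>Iteration \<open>i\<close> is performed iff no earlier iteration stops.\<close>

definition run_AS ::
  "(real ^ 'n \<Rightarrow> real) \<Rightarrow> (real ^ 'm \<Rightarrow> ereal) \<Rightarrow> real ^ 'n ^ 'm \<Rightarrow> real \<Rightarrow> real \<Rightarrow> 'm set \<Rightarrow>
     (nat \<Rightarrow> real ^ 'n) \<Rightarrow> (nat \<Rightarrow> real ^ 'm) \<Rightarrow> (nat \<Rightarrow> real ^ 'm) \<Rightarrow> bool" where
  "run_AS f p B lam eps I0 x y u \<longleftrightarrow>
     (\<forall>i. (\<forall>k<i. \<not> stops_AS f p B lam eps I0 x y u k) \<longrightarrow>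
       (let I = index_set p lam I0 y u i
        in \<exists>\<gamma> \<xi> w. primal_stage f p B lam eps I \<gamma> \<xi> (x i) (y i) \<and>
                   dual_recovery f p B lam I \<gamma> \<xi> (x i) (y i) (u i) w))"

definition run_EAS ::
  "(real ^ 'n \<Rightarrow> real) \<Rightarrow> (real ^ 'm \<Rightarrow> ereal) \<Rightarrow> real ^ 'n ^ 'm \<Rightarrow> real \<Rightarrow> real \<Rightarrow> 'm set \<Rightarrow>
     (nat \<Rightarrow> real ^ 'n) \<Rightarrow> (nat \<Rightarrow> real ^ 'm) \<Rightarrow> (nat \<Rightarrow> real ^ 'm) \<Rightarrow> (nat \<Rightarrow> real ^ 'm) \<Rightarrow>
     bool" where
  "run_EAS f p B lam eps I0 x y u v \<longleftrightarrow>
     (\<forall>i. (\<forall>k<i. \<not> stops_EAS f p B lam eps I0 x y u v k) \<longrightarrow>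
       (let I = index_set p lam I0 y u i
        in \<exists>\<gamma> \<xi>. primal_stage f p B lam eps I \<gamma> \<xi> (x i) (y i) \<and>
             (objective_test f p B lam eps x i \<longrightarrow>
               (\<exists>s. enhanced_dual_recovery f p B lam (x i) (v i) s)) \<and>
             (\<not> stops_early f p B lam eps x v i \<longrightarrow>
               (\<exists>w. dual_recovery f p B lam I \<gamma> \<xi> (x i) (y i) (u i) w))))"

definition iteration_count :: "(nat \<Rightarrow> bool) \<Rightarrow> enat" where
  "iteration_count stops = (if \<exists>i. stops i then enat (Suc (LEAST i. stops i)) else \<infinity>)"

definition output_EAS ::
  "(real ^ 'n \<Rightarrow> real) \<Rightarrow> (real ^ 'm \<Rightarrow> ereal) \<Rightarrow> real ^ 'n ^ 'm \<Rightarrow> real \<Rightarrow> real \<Rightarrow> 'm set \<Rightarrow>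
     (nat \<Rightarrow> real ^ 'n) \<Rightarrow> (nat \<Rightarrow> real ^ 'm) \<Rightarrow> (nat \<Rightarrow> real ^ 'm) \<Rightarrow> (nat \<Rightarrow> real ^ 'm) \<Rightarrow>
     (real ^ 'n) \<times> (real ^ 'm) \<times> (real ^ 'm)" where
  "output_EAS f p B lam eps I0 x y u v =
     (let N = (LEAST i. stops_EAS f p B lam eps I0 x y u v i)
      in if stops_early f p B lam eps x v N then (x N, B *v x N, v N) else (x N, y N, u N))"

end

theory Submission
  imports Defs
begin

text \<open>
  Each unstopped iteration removes an index, so the finite set \<open>I0\<close> bounds the number of
  iterations; the tests of Algorithm AS are among those of Algorithm EAS.

  The residual needs an argument only for a stop with no violated coordinate. There the recovered
  triple satisfies \<open>\<nabla>f(x) + B\<^sup>T u = - (\<delta>1 + \<delta>2)\<close> and \<open>B x = y\<close> exactly. Coordinatewise membership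
  makes \<open>u + \<delta>3\<close> a subgradient of \<open>\<lambda>p\<close> at \<open>y\<close>, so \<open>y = Prox (y + u + \<delta>3)\<close>, and nonexpansiveness
  of the proximal map bounds the middle residual by \<open>\<parallel>\<delta>3\<parallel>\<close>.
\<close>

declare transpose_matrix_vector [simp del]

section \<open>Zero-padded vectors and matrices\<close>

lemma subvec_nth [simp]: "subvec K v $ i = (if i \<in> K then v $ i else 0)"
  by (simp add: subvec_def)

lemma submat_nth [simp]: "submat K L A $ i $ j = (if i \<in> K \<and> j \<in> L then A $ i $ j else 0)"
  by (simp add: submat_def)

lemma subvec_eq_self_iff: "subvec K v = v \<longleftrightarrow> (\<forall>i. i \<notin> K \<longrightarrow> v $ i = 0)"
  by (auto simp: vec_eq_iff)

lemma submat_mult_subvec: "submat K L A *v subvec L v = submat K L A *v v"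
  by (auto simp: vec_eq_iff matrix_vector_mult_def intro!: sum.cong)

lemma subvec_mult_submat: "subvec K (submat K L A *v v) = submat K L A *v v"
  by (auto simp: vec_eq_iff matrix_vector_mult_def)

lemma transpose_submat: "transpose (submat K L A) = submat L K (transpose A)"
  by (auto simp: vec_eq_iff transpose_def)

lemma subvec_subvec: "subvec K (subvec L v) = subvec (K \<inter> L) v"
  by (auto simp: vec_eq_iff)

lemma subvec_empty [simp]: "subvec {} v = 0"
  by (simp add: vec_eq_iff)

lemma submat_mult_disjoint:
  assumes "subvec L' v = v" "L \<inter> L' = {}"
  shows "submat K L A *v v = 0"
proof -
  have "subvec L v = 0"
    by (metis assms subvec_empty subvec_subvec)
  then show ?thesis
    using submat_mult_subvec[of K L A v] by simp
qed

lemma submat_one_mult: "submat K K (mat 1) *v v = subvec K v"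
proof -
  have "(\<Sum>j\<in>UNIV. submat K K (mat 1) $ i $ j * v $ j) =
      (\<Sum>j\<in>UNIV. if j = i then subvec K v $ i else 0)" for i
    by (rule sum.cong) (auto simp: mat_def)
  then show ?thesis
    by (simp add: vec_eq_iff matrix_vector_mult_def)
qed

lemma submat_eq_mult:
  "submat K L (A :: real ^ 'n ^ 'm) = submat K K (mat 1) ** A ** submat L L (mat 1)"
proof -
  have "submat K L A *v v = subvec K (A *v subvec L v)" for v
    by (auto simp: vec_eq_iff matrix_vector_mult_def intro!: sum.cong)
  then show ?thesis
    by (simp add: matrix_eq submat_one_mult flip: matrix_vector_mul_assoc)
qed

lemma inner_transpose_mult:
  fixes A :: "real ^ 'n ^ 'm"
  shows "(transpose A *v w) \<bullet> v = w \<bullet> (A *v v)"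
  by (simp add: transpose_matrix_vector dot_lmul_matrix)

lemma full_column_rank_imp_inj:
  fixes A :: "real ^ 'n ^ 'm"
  assumes rank: "rank (submat I \<gamma> A) = card \<gamma>"
    and v: "subvec \<gamma> v = v" and Av: "submat I \<gamma> A *v v = 0"
  shows "v = 0"
proof -
  let ?A = "submat I \<gamma> A"
  let ?S = "{v :: real ^ 'n. \<forall>i. i \<notin> \<gamma> \<longrightarrow> v $ i = 0}"
  have sub: "range ((*v) (transpose ?A)) \<subseteq> ?S"
    by (auto simp: transpose_submat matrix_vector_mult_def)
  have "dim (range ((*v) (transpose ?A))) = card \<gamma>"
    using rank by (simp add: rank_transpose flip: rank_dim_range)
  moreover have "dim ?S = card \<gamma>"
    using dim_substandard_cart[of \<gamma>, where ?'a = real] by (simp add: dim_vec_eq)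
  moreover have "subspace (range ((*v) (transpose ?A)))"
    by (simp add: linear_subspace_image)
  moreover have "subspace ?S"
    by (auto simp: subspace_def)
  ultimately have "range ((*v) (transpose ?A)) = ?S"
    using sub by (intro subspace_dim_equal) auto
  moreover have "v \<in> ?S"
    using v by (simp add: subvec_eq_self_iff)
  ultimately have "v \<in> range ((*v) (transpose ?A))"
    by blast
  then obtain w where w: "v = transpose ?A *v w"
    by blast
  have "v \<bullet> v = w \<bullet> (?A *v v)"
    using inner_transpose_mult[of ?A w v] w by simp
  then show ?thesis
    using Av by simp
qed

lemma block_inv_gram:
  fixes A :: "real ^ 'n ^ 'm"
  assumes rank: "rank (submat I \<gamma> A) = card \<gamma>"
  defines "G \<equiv> transpose (submat I \<gamma> A) ** submat I \<gamma> A"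
  shows "G *v (block_inv \<gamma> G *v b) = subvec \<gamma> b"
proof -
  define Q :: "real ^ 'n ^ 'n" where "Q = submat \<gamma> \<gamma> (mat 1)"
  have Q_mult: "Q *v w = subvec \<gamma> w" for w
    by (simp add: Q_def submat_one_mult)
  have QQ: "Q ** Q = Q"
    by (simp add: matrix_eq Q_mult subvec_subvec flip: matrix_vector_mul_assoc)
  have QG: "Q ** G = G" and GQ: "G ** Q = G"
    by (simp_all add: matrix_eq G_def Q_mult transpose_submat subvec_mult_submat
        submat_mult_subvec flip: matrix_vector_mul_assoc)
  \<comment> \<open>Completing the Gram matrix by the identity outside \<open>\<gamma>\<close> makes it invertible.\<close>
  define T where "T = G + (mat 1 - Q)"
  have "w = 0" if "T *v w = 0" for w
  proof -
    have "G *v w + (w - Q *v w) = 0"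
      using that by (simp add: T_def matrix_vector_mult_add_rdistrib matrix_vector_mult_diff_rdistrib)
    moreover from this have "Q *v (G *v w + (w - Q *v w)) = 0"
      by simp
    then have "G *v w = 0"
      by (simp add: matrix_vector_right_distrib matrix_vector_mult_diff_distrib
          matrix_vector_mul_assoc QG QQ)
    ultimately have w: "subvec \<gamma> w = w"
      by (simp add: Q_mult)
    have "(submat I \<gamma> A *v w) \<bullet> (submat I \<gamma> A *v w) = w \<bullet> (G *v w)"
      unfolding G_def
      by (metis inner_transpose_mult inner_commute matrix_vector_mul_assoc)
    with \<open>G *v w = 0\<close> have "submat I \<gamma> A *v w = 0"
      by simp
    with rank w show ?thesis
      by (rule full_column_rank_imp_inj)
  qed
  then obtain T' where T': "T' ** T = mat 1"
    using matrix_left_invertible_ker by blast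
  then have T'2: "T ** T' = mat 1"
    by (simp add: matrix_left_right_inverse)
  have TQ: "T ** Q = G" "Q ** T = G"
  proof -
    have "G *v (Q *v w) = G *v w" "Q *v (G *v w) = G *v w" "Q *v (Q *v w) = Q *v w" for w
      by (simp_all add: matrix_vector_mul_assoc QQ QG GQ)
    then have "T *v (Q *v w) = G *v w" "Q *v (T *v w) = G *v w" for w
      by (simp_all add: T_def matrix_vector_mult_add_rdistrib matrix_vector_mult_diff_rdistrib
          matrix_vector_right_distrib matrix_vector_mult_diff_distrib)
    then show "T ** Q = G" "Q ** T = G"
      by (simp_all add: matrix_eq flip: matrix_vector_mul_assoc)
  qed
  have QT': "Q ** T' = T' ** Q"
  proof -
    have "Q ** T' = T' ** (T ** Q) ** T'"
      by (simp add: matrix_mul_assoc T')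
    also have "\<dots> = T' ** (Q ** T) ** T'"
      by (simp add: TQ)
    also have "\<dots> = T' ** Q ** (T ** T')"
      by (simp add: matrix_mul_assoc)
    finally show ?thesis
      by (simp add: T'2)
  qed
  define N where "N = Q ** T'"
  have QN: "Q ** N = N"
    by (simp add: N_def matrix_mul_assoc QQ)
  have NQ: "N ** Q = N"
    by (simp add: N_def QT' QQ flip: matrix_mul_assoc)
  have N: "submat \<gamma> \<gamma> N = N" "N ** G = Q" "G ** N = Q"
  proof -
    show "submat \<gamma> \<gamma> N = N"
      by (simp add: submat_eq_mult[of \<gamma> \<gamma> N] QN NQ flip: Q_def)
    have "N ** G = Q ** (T' ** T) ** Q"
      by (simp add: N_def matrix_mul_assoc flip: TQ(1))
    then show "N ** G = Q"
      by (simp add: T' QQ)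
    have "G ** N = Q ** (T ** T') ** Q"
      by (simp add: N_def QT' matrix_mul_assoc flip: TQ(2))
    then show "G ** N = Q"
      by (simp add: T'2 QQ)
  qed
  have "block_inv \<gamma> G = N"
    unfolding block_inv_def
  proof (rule the_equality)
    show "submat \<gamma> \<gamma> N = N \<and> N ** G = submat \<gamma> \<gamma> (mat 1) \<and> G ** N = submat \<gamma> \<gamma> (mat 1)"
      using N by (simp add: Q_def)
  next
    fix N' assume "submat \<gamma> \<gamma> N' = N' \<and> N' ** G = submat \<gamma> \<gamma> (mat 1) \<and> G ** N' = submat \<gamma> \<gamma> (mat 1)"
    then have N': "Q ** N' ** Q = N'" "N' ** G = Q"
      by (simp_all add: Q_def flip: submat_eq_mult)
    have "N' = Q ** N' ** (Q ** Q)"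
      by (simp add: N' QQ)
    also have "\<dots> = N' ** (G ** N)"
      by (simp add: N' N matrix_mul_assoc)
    also have "\<dots> = N"
      by (simp add: N' QN matrix_mul_assoc)
    finally show "N' = N" .
  qed
  then show ?thesis
    using N(3) by (simp add: matrix_vector_mul_assoc Q_mult)
qed

section \<open>The proximal map\<close>

lemma closed_proper_convex_scaled:
  assumes "closed_proper_convex p" "lam > 0"
  shows "closed_proper_convex (scaled lam p)"
proof -
  let ?L = "\<lambda>(w, t). (w, t / lam)"
  have "scaled lam p w \<le> ereal t \<longleftrightarrow> p w \<le> ereal (t / lam)" for w t
    using assms(2) by (cases "p w") (auto simp: scaled_def field_simps)
  then have "epi (scaled lam p) = ?L -` epi p"
    by (auto simp: epi_def)
  moreover have "linear ?L"
    by (auto intro!: linearI simp: add_divide_distrib)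
  then have "convex (?L -` epi p)"
    using assms(1) by (auto simp: closed_proper_convex_def intro: convex_linear_vimage)
  moreover have "continuous_on UNIV ?L"
    using assms(2) by (auto simp: case_prod_unfold intro!: continuous_intros)
  then have "closed (?L -` epi p)"
    using assms(1) by (auto simp: closed_proper_convex_def intro: closed_vimage)
  moreover have "scaled lam p w \<noteq> - \<infinity>" "scaled lam p w = \<infinity> \<longleftrightarrow> p w = \<infinity>" for w
    using assms by (cases "p w"; auto simp: scaled_def closed_proper_convex_def)+
  ultimately show ?thesis
    using assms(1) by (simp add: closed_proper_convex_def)
qed

lemma subdifferential_finite:
  assumes "closed_proper_convex h" "s \<in> subdifferential h y"
  obtains t where "h y = ereal t"
proof -
  obtain w where "h w \<noteq> \<infinity>"
    using assms(1) by (auto simp: closed_proper_convex_def)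
  moreover have "h y + ereal (s \<bullet> (w - y)) \<le> h w"
    using assms(2) by (simp add: subdifferential_def)
  ultimately have "h y \<noteq> \<infinity>"
    by auto
  moreover have "h y \<noteq> - \<infinity>"
    using assms(1) by (simp add: closed_proper_convex_def)
  ultimately show thesis
    using that by (cases "h y") auto
qed

text \<open>The affine minorant given by the subgradient makes the sublevel set compact.\<close>

lemma prox_is_arg_min:
  fixes h :: "'a :: euclidean_space \<Rightarrow> ereal"
  assumes h: "closed_proper_convex h" and s: "s \<in> subdifferential h y"
  shows "is_arg_min (\<lambda>w. h w + ereal ((norm (w - v))\<^sup>2 / 2)) (\<lambda>_. True) (prox h v)"
proof -
  obtain t0 where t0: "h y = ereal t0"
    using h s by (rule subdifferential_finite)
  define \<phi> where "\<phi> = (\<lambda>(w :: 'a, t :: real). t + (norm (w - v))\<^sup>2 / 2)"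
  have cont: "continuous_on X \<phi>" for X
    by (auto simp: \<phi>_def case_prod_unfold intro!: continuous_intros)
  define K where "K = epi h \<inter> {z. \<phi> z \<le> \<phi> (y, t0)}"
  have minorant: "t0 + s \<bullet> (w - y) \<le> t" if "(w, t) \<in> epi h" for w t
  proof -
    have "ereal t0 + ereal (s \<bullet> (w - y)) \<le> h w"
      using s t0 by (auto simp: subdifferential_def)
    also have "\<dots> \<le> ereal t"
      using that by (simp add: epi_def)
    finally show ?thesis
      by simp
  qed
  have "closed K"
    unfolding K_def using h cont
    by (auto simp: closed_proper_convex_def intro!: closed_Int closed_Collect_le)
  moreover have "bounded K"
  proof -
    define c where "c = \<phi> (y, t0) - t0 - s \<bullet> (v - y)"
    define r where "r = sqrt (2 * c + (norm s)\<^sup>2)"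
    have "w \<in> cball 0 (norm v + norm s + r) \<and>
          t \<in> {t0 - norm s * (norm v + norm s + r + norm y)..\<phi> (y, t0)}"
      if "(w, t) \<in> K" for w t
    proof -
      have t: "t + (norm (w - v))\<^sup>2 / 2 \<le> \<phi> (y, t0)" and min: "t0 + s \<bullet> (w - y) \<le> t"
        using that minorant by (auto simp: K_def \<phi>_def)
      have "(norm (w - v + s))\<^sup>2 = (norm (w - v))\<^sup>2 + 2 * (s \<bullet> (w - v)) + (norm s)\<^sup>2"
        by (simp add: power2_norm_eq_inner inner_add inner_commute)
      also have "\<dots> \<le> 2 * c + (norm s)\<^sup>2"
        using t min by (simp add: c_def inner_diff)
      finally have "norm (w - v + s) \<le> r"
        unfolding r_def using real_le_rsqrt by blast
      moreover have "norm w \<le> norm (w - v + s) + norm v + norm s"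
        using norm_triangle_ineq[of "w - v + s" "v - s"] norm_triangle_ineq4[of v s] by simp
      ultimately have w: "norm w \<le> norm v + norm s + r"
        by simp
      have "- (norm s * (norm v + norm s + r + norm y)) \<le> s \<bullet> (w - y)"
      proof -
        have "- (s \<bullet> (w - y)) \<le> norm s * norm (w - y)"
          using Cauchy_Schwarz_ineq2[of s "w - y"] by linarith
        also have "\<dots> \<le> norm s * (norm v + norm s + r + norm y)"
          using w norm_triangle_ineq4[of w y] by (intro mult_left_mono) auto
        finally show ?thesis
          by linarith
      qed
      moreover have "t \<le> \<phi> (y, t0)"
        using t by (smt (verit) divide_nonneg_nonneg zero_le_power2)
      ultimately show ?thesis
        using w min by auto
    qed
    then have "K \<subseteq> cball 0 (norm v + norm s + r) \<times>
        {t0 - norm s * (norm v + norm s + r + norm y)..\<phi> (y, t0)}"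
      by auto
    then show ?thesis
      by (rule bounded_subset[rotated]) (intro bounded_Times bounded_cball bounded_closed_interval)
  qed
  ultimately have "compact K"
    by (simp add: compact_eq_bounded_closed)
  moreover have yK: "(y, t0) \<in> K"
    using t0 by (simp add: K_def epi_def)
  ultimately obtain w t where wK: "(w, t) \<in> K" and least: "\<And>z. z \<in> K \<Longrightarrow> \<phi> (w, t) \<le> \<phi> z"
    using continuous_attains_inf[of K \<phi>] cont by (metis empty_iff surj_pair)
  have "\<not> h w' + ereal ((norm (w' - v))\<^sup>2 / 2) < h w + ereal ((norm (w - v))\<^sup>2 / 2)" for w'
  proof
    assume less: "h w' + ereal ((norm (w' - v))\<^sup>2 / 2) < h w + ereal ((norm (w - v))\<^sup>2 / 2)"
    also have "\<dots> \<le> ereal (\<phi> (w, t))"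
      using wK by (auto simp: K_def epi_def \<phi>_def add_right_mono simp flip: plus_ereal.simps)
    finally have less: "h w' + ereal ((norm (w' - v))\<^sup>2 / 2) < ereal (\<phi> (w, t))" .
    moreover have "h w' \<noteq> - \<infinity>"
      using h by (simp add: closed_proper_convex_def)
    ultimately obtain t' where t': "h w' = ereal t'"
      by (cases "h w'") auto
    with less have "\<phi> (w', t') < \<phi> (w, t)"
      by (simp add: \<phi>_def)
    moreover have "(w', t') \<in> K"
      using t' calculation least[OF yK] by (simp add: K_def epi_def)
    ultimately show False
      using least by fastforce
  qed
  then have "is_arg_min (\<lambda>w. h w + ereal ((norm (w - v))\<^sup>2 / 2)) (\<lambda>_. True) w"
    by (simp add: is_arg_min_def)
  then show ?thesis
    unfolding prox_def arg_min_def by (rule someI)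
qed

lemma arg_min_prox_subgradient:
  fixes h :: "'a :: euclidean_space \<Rightarrow> ereal"
  assumes h: "closed_proper_convex h"
    and min: "is_arg_min (\<lambda>w. h w + ereal ((norm (w - v))\<^sup>2 / 2)) (\<lambda>_. True) w"
  shows "v - w \<in> subdifferential h w"
proof -
  have least: "h w + ereal ((norm (w - v))\<^sup>2 / 2) \<le> h w' + ereal ((norm (w' - v))\<^sup>2 / 2)" for w'
    using min by (auto simp: is_arg_min_def not_less)
  have notm: "h w' \<noteq> - \<infinity>" for w'
    using h by (simp add: closed_proper_convex_def)
  obtain w0 where "h w0 \<noteq> \<infinity>"
    using h by (auto simp: closed_proper_convex_def)
  then have "h w \<noteq> \<infinity>"
    using least[of w0] by auto
  then obtain t where t: "h w = ereal t"
    using notm[of w] by (cases "h w") auto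
  have "h w + ereal ((v - w) \<bullet> (z - w)) \<le> h z" for z
  proof (cases "h z")
    case (real t')
    define d where "d = z - w"
    have step: "(v - w) \<bullet> d \<le> t' - t + e * (norm d)\<^sup>2 / 2" if e: "0 < e" "e \<le> 1" for e
    proof -
      have "(w, t) \<in> epi h" "(z, t') \<in> epi h"
        using t real by (simp_all add: epi_def)
      then have "(1 - e) *\<^sub>R (w, t) + e *\<^sub>R (z, t') \<in> epi h"
        using h e by (intro convexD) (auto simp: closed_proper_convex_def)
      moreover have "(1 - e) *\<^sub>R w + e *\<^sub>R z = w + e *\<^sub>R d"
        by (simp add: d_def algebra_simps)
      ultimately have "h (w + e *\<^sub>R d) \<le> ereal ((1 - e) * t + e * t')"
        by (simp add: epi_def)
      then have "h (w + e *\<^sub>R d) + ereal ((norm (w + e *\<^sub>R d - v))\<^sup>2 / 2)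
          \<le> ereal ((1 - e) * t + e * t') + ereal ((norm (w + e *\<^sub>R d - v))\<^sup>2 / 2)"
        by (rule add_right_mono)
      with least[of "w + e *\<^sub>R d"]
      have "h w + ereal ((norm (w - v))\<^sup>2 / 2)
          \<le> ereal ((1 - e) * t + e * t') + ereal ((norm (w + e *\<^sub>R d - v))\<^sup>2 / 2)"
        by (rule order_trans)
      then have "t + (norm (w - v))\<^sup>2 / 2
          \<le> (1 - e) * t + e * t' + (norm (w + e *\<^sub>R d - v))\<^sup>2 / 2"
        by (simp add: t)
      moreover have "(norm (w + e *\<^sub>R d - v))\<^sup>2
          = (norm (w - v))\<^sup>2 - 2 * e * ((v - w) \<bullet> d) + e * e * (norm d)\<^sup>2"
        by (simp only: power2_norm_eq_inner)
          (simp add: inner_add inner_diff inner_commute algebra_simps)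
      ultimately have "e * ((v - w) \<bullet> d) \<le> e * (t' - t + e * (norm d)\<^sup>2 / 2)"
        by (simp add: algebra_simps add_divide_distrib diff_divide_distrib)
      then show ?thesis
        using e by simp
    qed
    have "(v - w) \<bullet> d \<le> t' - t"
    proof (rule tendsto_lowerbound)
      have "((\<lambda>e. t' - t + e * (norm d)\<^sup>2 / 2) \<longlongrightarrow> t' - t + 0 * (norm d)\<^sup>2 / 2) (at_right 0)"
        by (intro tendsto_intros) auto
      then show "((\<lambda>e. t' - t + e * (norm d)\<^sup>2 / 2) \<longlongrightarrow> t' - t) (at_right 0)"
        by simp
      show "\<forall>\<^sub>F e in at_right 0. (v - w) \<bullet> d \<le> t' - t + e * (norm d)\<^sup>2 / 2"
        using step by (auto simp: eventually_at_right_field intro!: exI[of _ 1])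
    qed simp
    then show ?thesis
      by (simp add: t real d_def)
  qed (use notm in auto)
  then show ?thesis
    by (simp add: subdifferential_def)
qed

lemma subdifferential_monotone:
  assumes h: "closed_proper_convex h"
    and s: "s \<in> subdifferential h y" and s': "s' \<in> subdifferential h y'"
  shows "0 \<le> (s - s') \<bullet> (y - y')"
proof -
  obtain t where t: "h y = ereal t"
    using h s by (rule subdifferential_finite)
  obtain t' where t': "h y' = ereal t'"
    using h s' by (rule subdifferential_finite)
  have "h y + ereal (s \<bullet> (y' - y)) \<le> h y'" "h y' + ereal (s' \<bullet> (y - y')) \<le> h y"
    using s s' by (auto simp: subdifferential_def)
  then show ?thesis
    by (simp add: t t' inner_diff)
qed

lemma norm_diff_prox_le:
  fixes h :: "'a :: euclidean_space \<Rightarrow> ereal"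
  assumes h: "closed_proper_convex h" and s: "u + \<delta> \<in> subdifferential h y"
  shows "norm (y - prox h (y + u)) \<le> norm \<delta>"
proof -
  let ?w = "prox h (y + u)"
  have "y + u - ?w \<in> subdifferential h ?w"
    by (rule arg_min_prox_subgradient[OF h prox_is_arg_min[OF h s]])
  then have "0 \<le> ((u + \<delta>) - (y + u - ?w)) \<bullet> (y - ?w)"
    by (rule subdifferential_monotone[OF h s])
  then have "norm (y - ?w) * norm (y - ?w) \<le> \<delta> \<bullet> (y - ?w)"
    by (simp add: inner_diff flip: power2_eq_square power2_norm_eq_inner)
      (simp add: power2_norm_eq_inner inner_diff)
  also have "\<dots> \<le> norm \<delta> * norm (y - ?w)"
    by (rule norm_cauchy_schwarz)
  finally show ?thesis
    by (cases "y = ?w") auto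
qed

section \<open>The recovered triple\<close>

lemma reduction_decomposition:
  assumes red: "reduction B I \<alpha> \<beta> \<gamma> M"
  shows "B = (submat I \<gamma> B - submat I \<gamma> B ** M) +
    (submat (- I) \<alpha> B + submat (- I) \<beta> B + submat (- I) \<gamma> B)"
proof -
  have "B $ i $ j = (submat I \<alpha> B + submat I \<beta> B + submat I \<gamma> B +
      (submat (- I) \<alpha> B + submat (- I) \<beta> B + submat (- I) \<gamma> B)) $ i $ j" for i j
  proof -
    have "j \<in> \<alpha> \<union> \<beta> \<union> \<gamma>" "\<alpha> \<inter> \<beta> = {}" "\<alpha> \<inter> \<gamma> = {}" "\<beta> \<inter> \<gamma> = {}"
      using red by (auto simp: reduction_def)
    then show ?thesis
      by auto
  qed
  then have "B = submat I \<alpha> B + submat I \<beta> B + submat I \<gamma> B +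
      (submat (- I) \<alpha> B + submat (- I) \<beta> B + submat (- I) \<gamma> B)"
    unfolding vec_eq_iff by blast
  moreover have "submat I \<beta> B = 0" "submat I \<alpha> B = - (submat I \<gamma> B ** M)"
    using red by (auto simp: reduction_def eq_neg_iff_add_eq_0)
  ultimately show ?thesis
    by (metis (no_types) add.right_neutral add.commute uminus_add_conv_diff)
qed

lemma primal_recovery_feasible:
  assumes red: "reduction B I \<alpha> \<beta> \<gamma> M"
    and kkt: "inexact_kkt f p B lam I \<alpha> \<beta> \<gamma> M (x\<alpha>, x\<beta>, y, \<xi>) (\<delta>1, \<delta>2, \<delta>3)"
  shows "B *v (x\<alpha> + x\<beta> + M *v x\<alpha>) = y"
proof -
  let ?A = "submat I \<gamma> B"
  let ?C1 = "submat (- I) \<alpha> B" and ?C2 = "submat (- I) \<beta> B" and ?C3 = "submat (- I) \<gamma> B"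
  have disj: "\<alpha> \<inter> \<beta> = {}" "\<beta> \<inter> \<alpha> = {}" "\<gamma> \<inter> \<alpha> = {}" "\<gamma> \<inter> \<beta> = {}" "\<alpha> \<inter> \<gamma> = {}" "\<beta> \<inter> \<gamma> = {}"
    and M: "M = submat \<gamma> \<alpha> M"
    using red by (auto simp: reduction_def)
  have x: "subvec \<alpha> x\<alpha> = x\<alpha>" "subvec \<beta> x\<beta> = x\<beta>" "subvec \<gamma> (M *v w) = M *v w" for w
    using kkt M subvec_mult_submat[of \<gamma> \<alpha> M w] by (simp_all add: inexact_kkt_def Let_def)
  have M0: "M *v x\<beta> = 0" "M *v (M *v x\<alpha>) = 0"
    using M submat_mult_disjoint x disj by metis+
  have C0: "?C1 *v x\<beta> = 0" "?C1 *v (M *v x\<alpha>) = 0" "?C2 *v x\<alpha> = 0" "?C2 *v (M *v x\<alpha>) = 0"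
    "?C3 *v x\<alpha> = 0" "?C3 *v x\<beta> = 0" "?A *v x\<alpha> = 0" "?A *v x\<beta> = 0"
    using submat_mult_disjoint[OF x(1)] submat_mult_disjoint[OF x(2)] submat_mult_disjoint[OF x(3)] disj
    by auto
  have y: "(?C1 + ?C3 ** M) *v x\<alpha> + ?C2 *v x\<beta> - y = 0"
    using kkt by (simp add: inexact_kkt_def Let_def)
  have "B *v (x\<alpha> + x\<beta> + M *v x\<alpha>) = ((?A - ?A ** M) + (?C1 + ?C2 + ?C3)) *v (x\<alpha> + x\<beta> + M *v x\<alpha>)"
    using reduction_decomposition[OF red] by simp
  also have "\<dots> = ?C1 *v x\<alpha> + ?C2 *v x\<beta> + ?C3 *v (M *v x\<alpha>)"
    by (simp add: matrix_vector_mult_add_rdistrib matrix_vector_mult_diff_rdistrib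
        matrix_vector_right_distrib C0 M0 flip: matrix_vector_mul_assoc)
  also have "\<dots> = y"
    using y by (simp add: matrix_vector_mult_add_rdistrib algebra_simps flip: matrix_vector_mul_assoc)
  finally show ?thesis .
qed

lemma dual_recoveryE:
  assumes red: "reduction B I \<alpha> \<beta> \<gamma> M"
    and dual: "dual_recovery f p B lam I \<gamma> \<xi> x y u w"
  obtains ui where "u = \<xi> + ui" "subvec I ui = ui"
    "transpose (submat I \<gamma> B) *v ui =
       - (subvec \<gamma> (gradient f x) + transpose (submat (- I) \<gamma> B) *v \<xi>)"
proof -
  let ?A = "submat I \<gamma> B"
  define b where "b = subvec \<gamma> (gradient f x) + transpose (submat (- I) \<gamma> B) *v \<xi>"
  define u0 where "u0 = - (?A *v (block_inv \<gamma> (transpose ?A ** ?A) *v b))"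
  obtain d where d: "subvec I d = d" "transpose ?A *v d = 0" "u = \<xi> + (u0 + d)"
    using dual by (auto simp: dual_recovery_def Let_def is_arg_min_def b_def u0_def)
  have rank: "rank ?A = card \<gamma>"
    using red by (simp add: reduction_def)
  have b: "subvec \<gamma> b = b"
    by (simp add: b_def transpose_submat vec_eq_iff matrix_vector_mult_def)
  have "transpose ?A *v u0 = - ((transpose ?A ** ?A) *v (block_inv \<gamma> (transpose ?A ** ?A) *v b))"
    by (simp add: u0_def vec.neg flip: matrix_vector_mul_assoc)
  also have "\<dots> = - b"
    by (simp add: block_inv_gram[OF rank] b)
  finally have "transpose ?A *v (u0 + d) = - b"
    by (simp add: matrix_vector_right_distrib d)
  moreover have "subvec I (u0 + d) = u0 + d"
    using d(1) by (auto simp: u0_def subvec_eq_self_iff matrix_vector_mult_def)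
  ultimately show thesis
    using that d(3) by (simp add: b_def)
qed

lemma dual_recovery_stationary:
  assumes red: "reduction B I \<alpha> \<beta> \<gamma> M"
    and kkt: "inexact_kkt f p B lam I \<alpha> \<beta> \<gamma> M (x\<alpha>, x\<beta>, y, \<xi>) (\<delta>1, \<delta>2, \<delta>3)"
    and x: "x = x\<alpha> + x\<beta> + M *v x\<alpha>"
    and dual: "dual_recovery f p B lam I \<gamma> \<xi> x y u w"
  shows "gradient f x + transpose B *v u = - (\<delta>1 + \<delta>2)"
proof -
  let ?A = "submat I \<gamma> B"
  let ?C1 = "submat (- I) \<alpha> B" and ?C2 = "submat (- I) \<beta> B" and ?C3 = "submat (- I) \<gamma> B"
  let ?T = "\<lambda>A. transpose A *v u"
  define g where "g = gradient f x"
  define b where "b = subvec \<gamma> g + transpose ?C3 *v \<xi>"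
  obtain ui where u: "u = \<xi> + ui" "subvec I ui = ui" "transpose ?A *v ui = - b"
    using dual_recoveryE[OF red dual] by (auto simp: b_def g_def)
  have \<xi>: "subvec (- I) \<xi> = \<xi>"
    using kkt by (simp add: inexact_kkt_def Let_def)
  have "transpose ?A *v u = - b"
    using u submat_mult_disjoint[OF \<xi>, of I]
    by (simp add: transpose_submat matrix_vector_right_distrib)
  moreover have C: "?T (submat (- I) L B) = transpose (submat (- I) L B) *v \<xi>" for L
    using u submat_mult_disjoint[OF u(2), of "- I"]
    by (simp add: transpose_submat matrix_vector_right_distrib)
  moreover have "transpose B = transpose ?A - transpose M ** transpose ?A +
      (transpose ?C1 + transpose ?C2 + transpose ?C3)"
    by (subst reduction_decomposition[OF red])
      (simp add: transpose_def vec_eq_iff matrix_matrix_mult_def mult.commute)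
  ultimately have "transpose B *v u = - b + transpose M *v b +
      (transpose ?C1 *v \<xi> + transpose ?C2 *v \<xi> + transpose ?C3 *v \<xi>)"
    by (simp add: matrix_vector_mult_add_rdistrib matrix_vector_mult_diff_rdistrib vec.neg
        flip: matrix_vector_mul_assoc)
  moreover have "subvec \<alpha> g = g - subvec \<beta> g - subvec \<gamma> g"
  proof -
    have "subvec \<alpha> g $ j = (g - subvec \<beta> g - subvec \<gamma> g) $ j" for j
    proof -
      have "j \<in> \<alpha> \<union> \<beta> \<union> \<gamma>" "\<alpha> \<inter> \<beta> = {}" "\<alpha> \<inter> \<gamma> = {}" "\<beta> \<inter> \<gamma> = {}"
        using red by (auto simp: reduction_def)
      then show ?thesis
        by auto
    qed
    then show ?thesis
      unfolding vec_eq_iff by blast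
  qed
  moreover have "g + (- b + transpose M *v b +
      (transpose ?C1 *v \<xi> + transpose ?C2 *v \<xi> + transpose ?C3 *v \<xi>)) =
      ((g - subvec \<beta> g - subvec \<gamma> g) + transpose M *v b + transpose ?C1 *v \<xi>) +
      (subvec \<beta> g + transpose ?C2 *v \<xi>)"
    by (simp add: b_def)
  ultimately have "g + transpose B *v u =
      (subvec \<alpha> g + transpose M *v b + transpose ?C1 *v \<xi>) + (subvec \<beta> g + transpose ?C2 *v \<xi>)"
    by simp
  moreover have "subvec \<alpha> g + transpose M *v b + transpose ?C1 *v \<xi> = - \<delta>1"
  proof -
    have "transpose (?C1 + ?C3 ** M) = transpose ?C1 + transpose M ** transpose ?C3"
      by (simp add: transpose_def vec_eq_iff matrix_matrix_mult_def mult.commute)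
    moreover have "subvec \<alpha> g + transpose M *v subvec \<gamma> g + transpose (?C1 + ?C3 ** M) *v \<xi> + \<delta>1 = 0"
      using kkt by (simp add: inexact_kkt_def Let_def g_def x)
    ultimately show ?thesis
      by (simp add: b_def matrix_vector_mult_add_rdistrib matrix_vector_right_distrib
          eq_neg_iff_add_eq_0 add_ac flip: matrix_vector_mul_assoc)
  qed
  moreover have "subvec \<beta> g + transpose ?C2 *v \<xi> = - \<delta>2"
    using kkt by (simp add: inexact_kkt_def Let_def g_def x eq_neg_iff_add_eq_0)
  ultimately have "g + transpose B *v u = - (\<delta>1 + \<delta>2)"
    by simp
  then show ?thesis
    by (simp add: g_def)
qed

lemma recovered_subgradient:
  assumes red: "reduction B I \<alpha> \<beta> \<gamma> M"
    and kkt: "inexact_kkt f p B lam I \<alpha> \<beta> \<gamma> M (x\<alpha>, x\<beta>, y, \<xi>) (\<delta>1, \<delta>2, \<delta>3)"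
    and dual: "dual_recovery f p B lam I \<gamma> \<xi> x y u w"
    and removed: "removed p lam I y u = {}"
    and coord: "coordinatewise_subdifferential (scaled lam p)"
  shows "u + \<delta>3 \<in> subdifferential (scaled lam p) y"
proof -
  obtain ui where u: "u = \<xi> + ui" "subvec I ui = ui"
    using dual_recoveryE[OF red dual] by metis
  have \<delta>3: "subvec (- I) \<delta>3 = \<delta>3"
    using kkt by (simp add: inexact_kkt_def Let_def)
  obtain t where t: "t \<in> subdifferential (scaled lam p) y" "\<xi> + \<delta>3 = subvec (- I) t"
    using kkt by (auto simp: inexact_kkt_def Let_def)
  have "(u + \<delta>3) $ j \<in> (\<lambda>t. t $ j) ` subdifferential (scaled lam p) y" for j
  proof (cases "j \<in> I")
    case True
    with \<delta>3 have "(u + \<delta>3) $ j = u $ j"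
      by (simp add: subvec_eq_self_iff)
    with True removed show ?thesis
      by (auto simp: removed_def)
  next
    case False
    with u have "(u + \<delta>3) $ j = (\<xi> + \<delta>3) $ j"
      by (simp add: subvec_eq_self_iff)
    with False t show ?thesis
      by auto
  qed
  with coord show ?thesis
    unfolding coordinatewise_subdifferential_def by blast
qed

lemma kkt_residual_le:
  assumes p: "closed_proper_convex p" and lam: "lam > 0"
    and primal: "primal_stage f p B lam eps I \<gamma> \<xi> x y"
    and dual: "dual_recovery f p B lam I \<gamma> \<xi> x y u w"
    and removed: "removed p lam I y u = {}"
    and coord: "coordinatewise_subdifferential (scaled lam p)"
  shows "norm (kkt_residual f p B lam (x, y, u)) \<le> eps"
proof -
  obtain \<alpha> \<beta> M x\<alpha> x\<beta> \<delta>1 \<delta>2 \<delta>3 where red: "reduction B I \<alpha> \<beta> \<gamma> M"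
    and kkt: "inexact_kkt f p B lam I \<alpha> \<beta> \<gamma> M (x\<alpha>, x\<beta>, y, \<xi>) (\<delta>1, \<delta>2, \<delta>3)"
    and err: "norm \<delta>1 + norm \<delta>2 + norm \<delta>3 \<le> eps"
    and x: "x = x\<alpha> + x\<beta> + M *v x\<alpha>"
    using primal by (auto simp: primal_stage_def)
  let ?d = "y - prox (scaled lam p) (y + u)"
  have "kkt_residual f p B lam (x, y, u) = (- (\<delta>1 + \<delta>2), ?d, 0)"
    using dual_recovery_stationary[OF red kkt x dual] primal_recovery_feasible[OF red kkt]
    by (simp add: kkt_residual_def x)
  then have "norm (kkt_residual f p B lam (x, y, u)) \<le> norm (\<delta>1 + \<delta>2) + norm ?d"
    using norm_Pair_le[of "- (\<delta>1 + \<delta>2)" "(?d, 0 :: real ^ 'b)"]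
    by (simp add: norm_Pair del: minus_add_distrib)
  also have "norm (\<delta>1 + \<delta>2) \<le> norm \<delta>1 + norm \<delta>2"
    by (rule norm_triangle_ineq)
  also have "norm ?d \<le> norm \<delta>3"
    using closed_proper_convex_scaled[OF p lam]
      recovered_subgradient[OF red kkt dual removed coord]
    by (rule norm_diff_prox_le)
  finally show ?thesis
    using err by simp
qed

section \<open>Termination\<close>

lemma exists_removed_empty:
  "\<exists>i. removed p lam (index_set p lam I0 y u i) (y i) (u i) = {}"
proof (rule ccontr)
  assume nonempty: "\<not> ?thesis"
  let ?I = "index_set p lam I0 y u"
  have "card (?I i) + i \<le> card I0" for i
  proof (induction i)
    case (Suc i)
    have "?I (Suc i) \<subset> ?I i"
      using nonempty by (auto simp: removed_def)
    then have "card (?I (Suc i)) < card (?I i)"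
      by (intro psubset_card_mono) auto
    with Suc show ?case
      by linarith
  qed simp
  from this[of "Suc (card I0)"] show False
    by simp
qed

lemma iteration_count_antimono:
  assumes "\<And>i. P i \<Longrightarrow> Q i"
  shows "iteration_count Q \<le> iteration_count P"
  using assms by (auto simp: iteration_count_def intro: Least_le LeastI2_ex)

theorem theorem4:
  fixes f :: "real ^ 'n \<Rightarrow> real" and p :: "real ^ 'm \<Rightarrow> ereal" and B :: "real ^ 'n ^ 'm"
    and lam eps :: real and I0 :: "'m set"
    and x :: "nat \<Rightarrow> real ^ 'n" and y u v :: "nat \<Rightarrow> real ^ 'm"
  assumes "twice_continuously_differentiable f" and "convex_on UNIV f"
    and "closed_proper_convex p"
    and "assumption_A1 f p B" and "assumption_A2 p"
    and "lam > 0" and "eps > 0"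
    and "run_EAS f p B lam eps I0 x y u v"
  shows "iteration_count (stops_EAS f p B lam eps I0 x y u v) < \<infinity> \<and>
         (run_AS f p B lam eps I0 x y u \<longrightarrow>
           iteration_count (stops_EAS f p B lam eps I0 x y u v)
             \<le> iteration_count (stops_AS f p B lam eps I0 x y u)) \<and>
         (coordinatewise_subdifferential (scaled lam p) \<longrightarrow>
           norm (kkt_residual f p B lam (output_EAS f p B lam eps I0 x y u v)) \<le> eps)"
proof (intro conjI impI)
  let ?stops = "stops_EAS f p B lam eps I0 x y u v"
  have stops: "\<exists>i. ?stops i"
    using exists_removed_empty[of p lam I0 y u] by (auto simp: stops_EAS_def stops_AS_def)
  then show "iteration_count ?stops < \<infinity>"
    by (simp add: iteration_count_def)
  show "iteration_count ?stops \<le> iteration_count (stops_AS f p B lam eps I0 x y u)"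
    by (rule iteration_count_antimono) (simp add: stops_EAS_def)
  assume coord: "coordinatewise_subdifferential (scaled lam p)"
  define N where "N = (LEAST i. ?stops i)"
  have N: "?stops N" and performed: "\<forall>k<N. \<not> ?stops k"
    using stops by (auto simp: N_def intro: LeastI_ex dest: not_less_Least)
  show "norm (kkt_residual f p B lam (output_EAS f p B lam eps I0 x y u v)) \<le> eps"
  proof (cases "stops_early f p B lam eps x v N")
    case True
    then show ?thesis
      by (simp add: output_EAS_def stops_early_def flip: N_def)
  next
    case False
    obtain \<gamma> \<xi> w where
      "primal_stage f p B lam eps (index_set p lam I0 y u N) \<gamma> \<xi> (x N) (y N)"
      "dual_recovery f p B lam (index_set p lam I0 y u N) \<gamma> \<xi> (x N) (y N) (u N) w"
      using assms(8) performed False unfolding run_EAS_def Let_def by blast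
    then have "norm (kkt_residual f p B lam (x N, y N, u N)) \<le> eps"
      using N False kkt_residual_le[OF assms(3,6)] coord
      by (auto simp: stops_EAS_def stops_AS_def)
    with False show ?thesis
      by (simp add: output_EAS_def flip: N_def)
  qed
qed

end
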